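(* Let $q\ge1$ be an integer, let $b>0$ be real, and put $a=b(q+1-2\sqrt q)$ and $c_J(b)=2(qb^2)^{1/4}$. The wave kernels on $T_{q+1}$ associated with the shifted combinatorial Laplacian $b\Delta_{T_{q+1}}-b(q+1-2\sqrt q)I$ are given, for $x\in T_{q+1}$ with $|x|=r$, by $$W^{b(q+1-2\sqrt q),b}_{q+1}(r;t)=q^{-\frac r2}J_{2r}^{c_J(b)}(t)-(q-1)\sum_{\ell=1}^{\lfloor\frac{t-2r}{4}\rfloor}q^{-\frac{r+2\ell}{2}}J_{2r+4\ell}^{c_J(b)}(t),$$ and, for $t\ge1$, $$V^{b(q+1-2\sqrt q),b}_{q+1}(r;t)=\sum_{m=0}^{t-1}\left[q^{-\frac r2}J_{2r}^{c_J(b)}(m)-(q-1)\sum_{\ell=1}^{\lfloor\frac{t-2r}{4}\rfloor}q^{-\frac{r+2\ell}{2}}J_{2r+4\ell}^{c_J(b)}(m)\right].$$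
   Context: $T_{q+1}$ is the $(q+1)$-regular tree with root $x_0$, and $|x|=d(x_0,x)$ is the graph distance to the root. The combinatorial Laplacian is $\Delta_{T_{q+1}}f(x)=(q+1)f(x)-\sum_{y\sim x}f(y)$, and $\Delta_{q+1}^{a,b}=b\Delta_{T_{q+1}}-aI$. For $t\in\mathbb N_0$, $\partial_tf(t)=f(t+1)-f(t)$ and $\partial_t^2f(t)=f(t+2)-2f(t+1)+f(t)$. Wave kernels: $W_{q+1}^{a,b}$ and $V_{q+1}^{a,b}$ are the solutions of $\Delta_{q+1}^{a,b}U(x;t)+\partial_t^2U(x;t)=0$ ($x\in V(T_{q+1})$, $t\in\mathbb N_0$, the operator acting in $x$) with initial conditions, for all $x$: $W_{q+1}^{a,b}(x;0)=\delta_{x_0}(x)$, $\partial_tW_{q+1}^{a,b}(x;0)=0$; respectively $V_{q+1}^{a,b}(x;0)=0$, $\partial_tV_{q+1}^{a,b}(x;0)=\delta_{x_0}(x)$, where $\delta_{x_0}(x)=1$ if $x=x_0$ and $0$ otherwise. They depend on $x$ only through $r=|x|$ and are written $W_{q+1}^{a,b}(r;t)$, $V_{q+1}^{a,b}(r;t)$. Discrete $J$-Bessel functions: for $t,n\in\mathbb N_0$, $c\in\mathbb C$, $$J^{c}_{n}(t)=\sum_{\ell=0}^{\lfloor (t-n)/2\rfloor}\frac{(-1)^\ell\,t!}{\ell!\,(t-2\ell-n)!\,(n+\ell)!}\left(\frac c2\right)^{2\ell+n}\ \text{ if } n\le t,\qquad J_n^c(t)=0\ \text{ if } n>t.$$ Empty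 sums are zero. *)

theory Defs
  imports Complex_Main
begin

text \<open>
  A simple graph is given by a symmetric irreflexive adjacency relation; its vertex set is the
  whole type, so that the functions on the vertices are exactly the functions on the type.
\<close>

definition is_tree :: "('v \<Rightarrow> 'v \<Rightarrow> bool) \<Rightarrow> bool" where
  "is_tree adj \<longleftrightarrow>
     symp adj \<and> irreflp adj \<and>
     (\<forall>x y. adj\<^sup>*\<^sup>* x y) \<and>
     \<not> (\<exists>p. 3 \<le> length p \<and> distinct p \<and> successively adj p \<and> adj (last p) (hd p))"

definition regular_tree :: "nat \<Rightarrow> ('v \<Rightarrow> 'v \<Rightarrow> bool) \<Rightarrow> bool" where
  "regular_tree d adj \<longleftrightarrow>
     is_tree adj \<and> (\<forall>x. finite {y. adj x y} \<and> card {y. adj x y} = d)"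

text \<open>\<open>(adj ^^ n) x y\<close> says that there is a walk of length \<open>n\<close> from \<open>x\<close> to \<open>y\<close>.\<close>

definition graph_dist :: "('v \<Rightarrow> 'v \<Rightarrow> bool) \<Rightarrow> 'v \<Rightarrow> 'v \<Rightarrow> nat" where
  "graph_dist adj x y = (LEAST n. (adj ^^ n) x y)"

definition tree_laplacian :: "nat \<Rightarrow> ('v \<Rightarrow> 'v \<Rightarrow> bool) \<Rightarrow> ('v \<Rightarrow> real) \<Rightarrow> 'v \<Rightarrow> real" where
  "tree_laplacian q adj f x = (real q + 1) * f x - (\<Sum>y | adj x y. f y)"

definition shifted_laplacian ::
    "nat \<Rightarrow> real \<Rightarrow> real \<Rightarrow> ('v \<Rightarrow> 'v \<Rightarrow> bool) \<Rightarrow> ('v \<Rightarrow> real) \<Rightarrow> 'v \<Rightarrow> real" where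
  "shifted_laplacian q a b adj f x = b * tree_laplacian q adj f x - a * f x"

definition time_diff :: "(nat \<Rightarrow> real) \<Rightarrow> nat \<Rightarrow> real" where
  "time_diff f t = f (t + 1) - f t"

definition time_diff2 :: "(nat \<Rightarrow> real) \<Rightarrow> nat \<Rightarrow> real" where
  "time_diff2 f t = f (t + 2) - 2 * f (t + 1) + f t"

definition solves_wave_equation ::
    "nat \<Rightarrow> real \<Rightarrow> real \<Rightarrow> ('v \<Rightarrow> 'v \<Rightarrow> bool) \<Rightarrow> ('v \<Rightarrow> nat \<Rightarrow> real) \<Rightarrow> bool" where
  "solves_wave_equation q a b adj U \<longleftrightarrow>
     (\<forall>x t. shifted_laplacian q a b adj (\<lambda>y. U y t) x + time_diff2 (U x) t = 0)"

definition delta :: "'v \<Rightarrow> 'v \<Rightarrow> real" where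
  "delta x0 x = (if x = x0 then 1 else 0)"

text \<open>
  Existence and uniqueness of the solution, as needed for the two descriptions below, is
  \<open>wave_equation_ex1\<close>.
\<close>

definition wave_kernel_W ::
    "nat \<Rightarrow> real \<Rightarrow> real \<Rightarrow> ('v \<Rightarrow> 'v \<Rightarrow> bool) \<Rightarrow> 'v \<Rightarrow> 'v \<Rightarrow> nat \<Rightarrow> real" where
  "wave_kernel_W q a b adj x0 =
     (THE U. solves_wave_equation q a b adj U \<and>
             (\<forall>x. U x 0 = delta x0 x) \<and> (\<forall>x. time_diff (U x) 0 = 0))"

definition wave_kernel_V ::
    "nat \<Rightarrow> real \<Rightarrow> real \<Rightarrow> ('v \<Rightarrow> 'v \<Rightarrow> bool) \<Rightarrow> 'v \<Rightarrow> 'v \<Rightarrow> nat \<Rightarrow> real" where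
  "wave_kernel_V q a b adj x0 =
     (THE U. solves_wave_equation q a b adj U \<and>
             (\<forall>x. U x 0 = 0) \<and> (\<forall>x. time_diff (U x) 0 = delta x0 x))"

text \<open>
  The parameter \<open>c\<close> lives in any field of characteristic zero; this covers complex \<open>c\<close>, and
  real \<open>c\<close> without coercions.
\<close>

definition discrete_bessel_J :: "nat \<Rightarrow> 'a::field_char_0 \<Rightarrow> nat \<Rightarrow> 'a" where
  "discrete_bessel_J n c t =
     (if n \<le> t
      then \<Sum>l = 0..(t - n) div 2.
             (-1) ^ l * fact t / (fact l * fact (t - 2 * l - n) * fact (n + l))
               * (c / 2) ^ (2 * l + n)
      else 0)"

definition c_J :: "nat \<Rightarrow> real \<Rightarrow> real" where
  "c_J q b = 2 * (real q * b\<^sup>2) powr (1 / 4)"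

fun wave_solution ::
    "nat \<Rightarrow> real \<Rightarrow> real \<Rightarrow> ('v \<Rightarrow> 'v \<Rightarrow> bool) \<Rightarrow> ('v \<Rightarrow> real) \<Rightarrow> ('v \<Rightarrow> real) \<Rightarrow> nat \<Rightarrow> 'v \<Rightarrow> real" where
  "wave_solution q a b adj f g 0 = f"
| "wave_solution q a b adj f g (Suc 0) = (\<lambda>x. f x + g x)"
| "wave_solution q a b adj f g (Suc (Suc t)) =
     (\<lambda>x. 2 * wave_solution q a b adj f g (Suc t) x - wave_solution q a b adj f g t x
        - shifted_laplacian q a b adj (wave_solution q a b adj f g t) x)"

lemma wave_equation_iff:
  "solves_wave_equation q a b adj U \<and> (\<forall>x. U x 0 = f x) \<and> (\<forall>x. time_diff (U x) 0 = g x)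
     \<longleftrightarrow> U = (\<lambda>x t. wave_solution q a b adj f g t x)"
proof
  assume U: "solves_wave_equation q a b adj U \<and> (\<forall>x. U x 0 = f x) \<and> (\<forall>x. time_diff (U x) 0 = g x)"
  have "(\<lambda>x. U x t) = wave_solution q a b adj f g t \<and>
        (\<lambda>x. U x (Suc t)) = wave_solution q a b adj f g (Suc t)" for t
  proof (induction t)
    case 0
    have "U x (Suc 0) = f x + g x" for x
      using U by (auto simp: time_diff_def algebra_simps dest: spec[of _ x])
    then show ?case using U by auto
  next
    case (Suc t)
    have "U x (Suc (Suc t)) = 2 * U x (Suc t) - U x t - shifted_laplacian q a b adj (\<lambda>y. U y t) x" for x
    proof -
      have "shifted_laplacian q a b adj (\<lambda>y. U y t) x + time_diff2 (U x) t = 0"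
        using U by (simp add: solves_wave_equation_def)
      then show ?thesis by (simp add: time_diff2_def)
    qed
    moreover have "U x t = wave_solution q a b adj f g t x"
      and "U x (Suc t) = wave_solution q a b adj f g (Suc t) x" for x
      using Suc by (metis (no_types))+
    ultimately show ?case using Suc by simp
  qed
  then show "U = (\<lambda>x t. wave_solution q a b adj f g t x)"
    by (metis (no_types))
qed (simp add: solves_wave_equation_def time_diff_def time_diff2_def)

lemma wave_equation_ex1:
  "\<exists>!U. solves_wave_equation q a b adj U \<and>
        (\<forall>x. U x 0 = f x) \<and> (\<forall>x. time_diff (U x) 0 = g x)"
  unfolding wave_equation_iff by simp

end

theory Submission
  imports Defs
begin

text \<open>
  The shift \<open>a = b(q + 1 - 2\<surd>q)\<close> turns the wave equation into
  \<open>\<partial>\<^sub>t\<^sup>2 U = b (A U - 2\<surd>q U)\<close>, where \<open>A\<close> is the adjacency operator. On a function of the distance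
  \<open>r\<close> to the root, \<open>A\<close> acts by \<open>f(r-1) + q f(r+1)\<close> for \<open>r \<ge> 1\<close> and by \<open>(q+1) f(1)\<close> at the
  root (\<open>regular_tree_neighbour_sum\<close>). Conjugating by \<open>q\<^bsup>-r/2\<^esup>\<close> makes this \<open>\<surd>q\<close> times the
  symmetric operator \<open>g(r-1) + g(r+1)\<close>, away from the root.

  On the other side, Pascal's rule gives
  \<open>\<partial>\<^sub>t J\<^sub>n = (c/2) (J\<^sub>n\<^sub>-\<^sub>1 - J\<^sub>n\<^sub>+\<^sub>1)\<close>, hence
  \<open>\<partial>\<^sub>t\<^sup>2 J\<^sub>n = (c/2)\<^sup>2 (J\<^sub>n\<^sub>-\<^sub>2 - 2 J\<^sub>n + J\<^sub>n\<^sub>+\<^sub>2)\<close>, with the convention \<open>J\<^sub>-\<^sub>n = (-1)\<^sup>n J\<^sub>n\<close>. The choice of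
  \<open>c\<close> makes \<open>(c/2)\<^sup>2 = b\<surd>q\<close>, so every family \<open>q\<^bsup>-r/2\<^esup> J\<^bsub>2r+k\<^esub>\<close> solves the
  equation away from the root (\<open>wave_profile_diff2_Suc\<close>). The equation at the root asks that
  replacing the order \<open>n\<close> by \<open>n - 2\<close> in the value at \<open>r = 0\<close> give \<open>1/q\<close> times the result of replacing
  it by \<open>n + 2\<close>. The coefficients \<open>-(q-1) q\<^bsup>-l\<^esup>\<close> of \<open>J\<^bsub>4l\<^esub>\<close> are the ones for
  which this telescopes (\<open>wave_profile_diff2_0\<close>). At \<open>t = 0\<close> and \<open>t = 1\<close> only
  \<open>J\<^sub>0 = 1\<close> is nonzero among the even orders, so the initial conditions hold.

  The formula for \<open>V\<close> follows because \<open>\<partial>\<^sub>t V\<close> solves the same equation with the initial conditions of \<open>W\<close>,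
  so that \<open>V\<close> is the sum of \<open>W\<close> over the earlier times.
\<close>

section \<open>Discrete Bessel functions\<close>

text \<open>
  The binomial coefficient \<open>t choose (2l+n)\<close> vanishes past the end of the defining sum, so one
  upper limit serves all orders and all times up to \<open>N\<close>; this removes the distinction between
  \<open>n \<le> t\<close> and \<open>n > t\<close> from the recurrences.
\<close>

lemma discrete_bessel_J_binomial:
  fixes c :: "'a::field_char_0"
  assumes "t \<le> N"
  shows "discrete_bessel_J n c t =
    (\<Sum>l\<le>N. (-1) ^ l * of_nat (t choose (2 * l + n)) * of_nat ((2 * l + n) choose l)
              * (c / 2) ^ (2 * l + n))" (is "_ = (\<Sum>l\<le>N. ?f l)")
proof (cases "n \<le> t")
  case True
  have "discrete_bessel_J n c t = (\<Sum>l = 0..(t - n) div 2. ?f l)"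
    unfolding discrete_bessel_J_def if_P[OF True]
  proof (rule sum.cong[OF refl])
    fix l assume "l \<in> {0..(t - n) div 2}"
    then have le: "2 * l + n \<le> t" using True by simp
    have t1: "of_nat (t choose (2 * l + n)) =
        (fact t / (fact (2 * l + n) * fact (t - 2 * l - n)) :: 'a)"
      using binomial_fact[OF le, where ?'a = 'a] by (simp add: diff_diff_eq)
    have t2: "of_nat ((2 * l + n) choose l) =
        (fact (2 * l + n) / (fact l * fact (n + l)) :: 'a)"
      using binomial_fact[of l "2 * l + n", where ?'a = 'a] by (simp add: add.commute mult_2)
    show "(-1) ^ l * fact t / (fact l * fact (t - 2 * l - n) * fact (n + l)) * (c / 2) ^ (2 * l + n) = ?f l"
      unfolding t1 t2 by simp
  qed
  also have "\<dots> = (\<Sum>l\<le>N. ?f l)"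
    by (rule sum.mono_neutral_left) (use assms True in \<open>auto intro!: binomial_eq_0\<close>)
  finally show ?thesis .
next
  case False
  then show ?thesis by (simp add: discrete_bessel_J_def binomial_eq_0)
qed

lemma discrete_bessel_J_eq_0: "t < n \<Longrightarrow> discrete_bessel_J n c t = 0"
  by (simp add: discrete_bessel_J_def)

lemma discrete_bessel_J_0_0 [simp]: "discrete_bessel_J 0 c 0 = 1"
  by (simp add: discrete_bessel_J_def)

text \<open>
  Pascal's rule for \<open>t choose k\<close> computes the difference in \<open>t\<close>; Pascal's rule for the other binomial
  coefficient splits the result into the two neighbouring orders.
\<close>

lemma discrete_bessel_J_diff_Suc:
  "discrete_bessel_J (Suc n) c (Suc t) - discrete_bessel_J (Suc n) c t =
     c / 2 * (discrete_bessel_J n c t - discrete_bessel_J (Suc (Suc n)) c t)"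
proof -
  define B :: "nat \<Rightarrow> 'a" where "B k = of_nat (t choose k)" for k
  \<comment> \<open>the summand of Pascal's rule with the smaller lower index, which yields the order \<open>n + 2\<close>\<close>
  define lower :: "nat \<Rightarrow> 'a"
    where "lower l = (case l of 0 \<Rightarrow> 0 | Suc k \<Rightarrow> of_nat ((2 * l + n) choose k))" for l
  have "discrete_bessel_J (Suc n) c (Suc t) - discrete_bessel_J (Suc n) c t =
      (\<Sum>l\<le>Suc t. (-1) ^ l * B (2 * l + n) * of_nat (Suc (2 * l + n) choose l)
                   * (c / 2) ^ Suc (2 * l + n))"
    by (subst (1 2) discrete_bessel_J_binomial[where N = "Suc t"])
      (simp_all flip: sum_subtractf add: B_def algebra_simps del: power_Suc)
  also have "\<dots> = (\<Sum>l\<le>Suc t. (-1) ^ l * B (2 * l + n) * of_nat ((2 * l + n) choose l)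
                   * (c / 2) ^ Suc (2 * l + n))
      + (\<Sum>l\<le>Suc t. (-1) ^ l * B (2 * l + n) * lower l * (c / 2) ^ Suc (2 * l + n))"
  proof -
    have "of_nat (Suc (2 * l + n) choose l) = of_nat ((2 * l + n) choose l) + lower l" for l
      by (cases l) (simp_all add: lower_def)
    then show ?thesis
      by (simp only: distrib_left distrib_right sum.distrib)
  qed
  also have "(\<Sum>l\<le>Suc t. (-1) ^ l * B (2 * l + n) * of_nat ((2 * l + n) choose l)
                   * (c / 2) ^ Suc (2 * l + n)) = c / 2 * discrete_bessel_J n c t"
    by (subst discrete_bessel_J_binomial[where N = "Suc t"])
      (simp_all add: sum_distrib_left B_def mult_ac del: sum.atMost_Suc)
  also have "(\<Sum>l\<le>Suc t. (-1) ^ l * B (2 * l + n) * lower l * (c / 2) ^ Suc (2 * l + n))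
      = - (c / 2 * discrete_bessel_J (Suc (Suc n)) c t)"
    by (subst sum.atMost_Suc_shift, subst discrete_bessel_J_binomial[where N = t])
      (simp_all add: sum_distrib_left B_def lower_def sum_negf mult_ac)
  finally show ?thesis by (simp add: algebra_simps)
qed

text \<open>
  The case of order \<open>0\<close> of the same recurrence, where \<open>J\<^sub>-\<^sub>1\<close> reads \<open>-J\<^sub>1\<close>: the two summands of Pascal's
  rule for the central binomial coefficient coincide.
\<close>

lemma discrete_bessel_J_diff_0:
  "discrete_bessel_J 0 c (Suc t) - discrete_bessel_J 0 c t = - (c * discrete_bessel_J (Suc 0) c t)"
proof -
  have central: "Suc (Suc (2 * l)) choose Suc l = 2 * (Suc (2 * l) choose l)" for l
    using binomial_symmetric[of l "Suc (2 * l)"] by (simp add: mult_2)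
  have "discrete_bessel_J 0 c (Suc t) - discrete_bessel_J 0 c t =
      (\<Sum>l\<le>t. (-1) ^ Suc l * of_nat (t choose Suc (2 * l)) * of_nat (Suc (Suc (2 * l)) choose Suc l)
                   * (c / 2) ^ Suc (Suc (2 * l)))"
    by (subst (1 2) discrete_bessel_J_binomial[where N = "Suc t"])
      (simp_all flip: sum_subtractf add: sum.atMost_Suc_shift algebra_simps del: power_Suc sum.atMost_Suc)
  also have "\<dots> = - (c * discrete_bessel_J (Suc 0) c t)"
    unfolding central
    by (subst discrete_bessel_J_binomial[where N = t])
      (simp_all add: sum_distrib_left sum_negf mult_ac)
  finally show ?thesis .
qed

lemma discrete_bessel_J_diff2_Suc_Suc:
  "time_diff2 (discrete_bessel_J (n + 2) c) t =
     (c / 2)\<^sup>2 * (discrete_bessel_J n c t - 2 * discrete_bessel_J (n + 2) c t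
                 + discrete_bessel_J (n + 4) c t)"
proof -
  note d = discrete_bessel_J_diff_Suc[of _ c]
  have "time_diff2 (discrete_bessel_J (n + 2) c) t =
      (discrete_bessel_J (n + 2) c (Suc (Suc t)) - discrete_bessel_J (n + 2) c (Suc t))
      - (discrete_bessel_J (n + 2) c (Suc t) - discrete_bessel_J (n + 2) c t)"
    by (simp add: time_diff2_def)
  also have "\<dots> = c / 2 * ((discrete_bessel_J (Suc n) c (Suc t) - discrete_bessel_J (Suc n) c t)
      - (discrete_bessel_J (n + 3) c (Suc t) - discrete_bessel_J (n + 3) c t))"
    using d[of "Suc n" t] d[of "Suc n" "Suc t"] by (simp add: right_diff_distrib numeral_eq_Suc)
  also have "\<dots> = (c / 2)\<^sup>2 * (discrete_bessel_J n c t - 2 * discrete_bessel_J (n + 2) c t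
                 + discrete_bessel_J (n + 4) c t)"
    using d[of n t] d[of "Suc (Suc n)" t]
    by (simp add: eval_nat_numeral) (simp add: algebra_simps)
  finally show ?thesis .
qed

lemma discrete_bessel_J_diff2_0:
  "time_diff2 (discrete_bessel_J 0 c) t =
     (c / 2)\<^sup>2 * (2 * discrete_bessel_J 2 c t - 2 * discrete_bessel_J 0 c t)"
proof -
  have "time_diff2 (discrete_bessel_J 0 c) t =
      (discrete_bessel_J 0 c (Suc (Suc t)) - discrete_bessel_J 0 c (Suc t))
      - (discrete_bessel_J 0 c (Suc t) - discrete_bessel_J 0 c t)"
    by (simp add: time_diff2_def)
  also have "\<dots> = - c * (discrete_bessel_J (Suc 0) c (Suc t) - discrete_bessel_J (Suc 0) c t)"
    unfolding discrete_bessel_J_diff_0 by (simp add: algebra_simps)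
  also have "\<dots> = (c / 2)\<^sup>2 * (2 * discrete_bessel_J 2 c t - 2 * discrete_bessel_J 0 c t)"
    unfolding discrete_bessel_J_diff_Suc
    by (simp add: algebra_simps power2_eq_square numeral_2_eq_2)
  finally show ?thesis .
qed

section \<open>The radial wave equation\<close>

text \<open>
  Here \<open>s\<close> stands for \<open>\<surd>q\<close>. The number \<open>N\<close> of correction terms does not vary with \<open>r\<close> and \<open>t\<close>, so that
  neighbouring values have the same number of terms; by \<open>wave_profile_cong\<close> its value is
  immaterial once it is large compared with \<open>t\<close>.
\<close>

definition wave_profile :: "real \<Rightarrow> real \<Rightarrow> nat \<Rightarrow> nat \<Rightarrow> nat \<Rightarrow> real" where
  "wave_profile s c N r t =
     (1 / s) ^ r * discrete_bessel_J (2 * r) c t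
     - (s\<^sup>2 - 1) * (\<Sum>l = 1..N. (1 / s) ^ (r + 2 * l) * discrete_bessel_J (2 * r + 4 * l) c t)"

lemma wave_profile_cong:
  assumes "t < 2 * r + 4 * (M + 1)" "t < 2 * r + 4 * (N + 1)"
  shows "wave_profile s c M r t = wave_profile s c N r t"
proof -
  define f where "f l = (1 / s) ^ (r + 2 * l) * discrete_bessel_J (2 * r + 4 * l) c t" for l
  have "(\<Sum>l = 1..M. f l) = (\<Sum>l = 1..min M N. f l)"
    by (rule sum.mono_neutral_right)
      (use assms in \<open>auto simp: f_def intro!: discrete_bessel_J_eq_0\<close>)
  moreover have "(\<Sum>l = 1..N. f l) = (\<Sum>l = 1..min M N. f l)"
    by (rule sum.mono_neutral_right)
      (use assms in \<open>auto simp: f_def intro!: discrete_bessel_J_eq_0\<close>)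
  ultimately show ?thesis by (simp add: wave_profile_def f_def)
qed

lemma wave_profile_diff2:
  "time_diff2 (wave_profile s c N r) t =
     (1 / s) ^ r * time_diff2 (discrete_bessel_J (2 * r) c) t
     - (s\<^sup>2 - 1) * (\<Sum>l = 1..N. (1 / s) ^ (r + 2 * l)
                                * time_diff2 (discrete_bessel_J (2 * r + 4 * l) c) t)"
  by (simp add: wave_profile_def time_diff2_def sum.distrib sum_subtractf sum_distrib_left algebra_simps)

lemma wave_profile_diff2_Suc:
  assumes "s \<noteq> 0"
  shows "time_diff2 (wave_profile s c N (Suc r)) t =
    (c / 2)\<^sup>2 * (wave_profile s c N r t / s + s * wave_profile s c N (r + 2) t
                - 2 * wave_profile s c N (Suc r) t)"
proof -
  have J: "time_diff2 (discrete_bessel_J (2 * Suc r + k) c) t =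
     (c / 2)\<^sup>2 * (discrete_bessel_J (2 * r + k) c t - 2 * discrete_bessel_J (2 * Suc r + k) c t
                 + discrete_bessel_J (2 * (r + 2) + k) c t)" for k
    using discrete_bessel_J_diff2_Suc_Suc[of "2 * r + k" c t] by (simp add: eval_nat_numeral)
  note J0 = J[of 0, simplified add_0_right]
  have p: "(1 / s) ^ (r + k) / s = (1 / s) ^ (Suc r + k)"
    "s * (1 / s) ^ (r + 2 + k) = (1 / s) ^ (Suc r + k)" for k
    using assms by (simp_all add: field_simps)
  note p0 = p[of 0, simplified add_0_right]
  have down: "wave_profile s c N r t / s = (1 / s) ^ Suc r * discrete_bessel_J (2 * r) c t
     - (s\<^sup>2 - 1) * (\<Sum>l = 1..N. (1 / s) ^ (Suc r + 2 * l) * discrete_bessel_J (2 * r + 4 * l) c t)"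
    unfolding wave_profile_def p0(1)[symmetric] p(1)[symmetric]
    by (simp add: diff_divide_distrib flip: sum_divide_distrib)
  have up: "s * wave_profile s c N (r + 2) t = (1 / s) ^ Suc r * discrete_bessel_J (2 * (r + 2)) c t
     - (s\<^sup>2 - 1) * (\<Sum>l = 1..N. (1 / s) ^ (Suc r + 2 * l) * discrete_bessel_J (2 * (r + 2) + 4 * l) c t)"
    unfolding wave_profile_def p0(2)[symmetric] p(2)[symmetric]
    by (simp only: right_diff_distrib sum_distrib_left mult_ac)
  have "time_diff2 (wave_profile s c N (Suc r)) t = (c / 2)\<^sup>2 *
     ((1 / s) ^ Suc r * (discrete_bessel_J (2 * r) c t - 2 * discrete_bessel_J (2 * Suc r) c t
                          + discrete_bessel_J (2 * (r + 2)) c t)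
      - (s\<^sup>2 - 1) * (\<Sum>l = 1..N. (1 / s) ^ (Suc r + 2 * l) *
          (discrete_bessel_J (2 * r + 4 * l) c t - 2 * discrete_bessel_J (2 * Suc r + 4 * l) c t
           + discrete_bessel_J (2 * (r + 2) + 4 * l) c t)))"
    unfolding wave_profile_diff2 J J0 by (simp only: right_diff_distrib sum_distrib_left mult_ac)
  also have "\<dots> = (c / 2)\<^sup>2 * (wave_profile s c N r t / s + s * wave_profile s c N (r + 2) t
                - 2 * wave_profile s c N (Suc r) t)"
    unfolding down up
    by (simp only: wave_profile_def right_diff_distrib distrib_left sum.distrib sum_subtractf
        sum_distrib_left mult_ac)
  finally show ?thesis .
qed

text \<open>
  At the root the lowered orders \<open>4l - 2\<close> are the raised orders \<open>4(l-1) + 2\<close> of the preceding term, and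
  the coefficient \<open>-(q-1)q\<^bsup>-l\<^esup>\<close> is \<open>1/q\<close> times the preceding one, except that at \<open>l = 1\<close> it
  combines with \<open>J\<^sub>-\<^sub>2 = J\<^sub>2\<close> into \<open>1 - (q-1)/q = 1/q\<close>. Only the last raised term has no partner, and
  it vanishes when \<open>t < 4N + 2\<close>.
\<close>

lemma wave_profile_diff2_0:
  assumes "s \<noteq> 0" "t < 4 * N + 2"
  shows "time_diff2 (wave_profile s c N 0) t =
    (c / 2)\<^sup>2 * ((s + 1 / s) * wave_profile s c N (Suc 0) t - 2 * wave_profile s c N 0 t)"
proof -
  define j where "j k = discrete_bessel_J (4 * k + 2) c t" for k
  define raised where "raised = j 0 - (s\<^sup>2 - 1) * (\<Sum>l = 1..N. (1 / s) ^ (2 * l) * j l)"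
  define lowered where "lowered = j 0 - (s\<^sup>2 - 1) * (\<Sum>l = 1..N. (1 / s) ^ (2 * l) * j (l - 1))"
  have jN: "j N = 0" using assms(2) by (simp add: j_def discrete_bessel_J_eq_0)
  have "(\<Sum>l = 1..N. (1 / s) ^ (2 * l) * j (l - 1)) = (\<Sum>k<N. (1 / s) ^ (2 * k + 2) * j k)"
    by (simp add: sum.atLeast1_atMost_eq)
  also have "\<dots> = (\<Sum>k\<le>N. (1 / s) ^ (2 * k + 2) * j k)"
    using jN by (simp flip: lessThan_Suc_atMost)
  also have "\<dots> = (j 0 + (\<Sum>l = 1..N. (1 / s) ^ (2 * l) * j l)) / s\<^sup>2"
    using assms(1)
    by (simp add: sum.atMost_shift sum.atLeast1_atMost_eq add_divide_distrib sum_divide_distrib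
        power_divide power2_eq_square mult_ac)
  finally have low: "lowered = raised / s\<^sup>2"
    using assms(1) by (simp add: lowered_def raised_def field_simps)
  have J: "time_diff2 (discrete_bessel_J (4 * l) c) t =
     (c / 2)\<^sup>2 * (j (l - 1) - 2 * discrete_bessel_J (4 * l) c t + j l)" if "1 \<le> l" for l
  proof -
    have "4 * (l - 1) + 2 + 2 = 4 * l" "4 * (l - 1) + 2 + 4 = 4 * l + 2" using that by auto
    then show ?thesis
      using discrete_bessel_J_diff2_Suc_Suc[of "4 * (l - 1) + 2" c t] by (simp only: j_def)
  qed
  have J0: "time_diff2 (discrete_bessel_J 0 c) t = (c / 2)\<^sup>2 * (j 0 - 2 * discrete_bessel_J 0 c t + j 0)"
    using discrete_bessel_J_diff2_0[of c t] by (simp add: j_def flip: numeral_2_eq_2)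
  have JS: "(\<Sum>l = 1..N. (1 / s) ^ (2 * l) * time_diff2 (discrete_bessel_J (4 * l) c) t) =
      (\<Sum>l = 1..N. (1 / s) ^ (2 * l) *
         ((c / 2)\<^sup>2 * (j (l - 1) - 2 * discrete_bessel_J (4 * l) c t + j l)))"
    by (intro sum.cong refl) (simp add: J)
  have "time_diff2 (wave_profile s c N 0) t =
      (c / 2)\<^sup>2 * ((j 0 - 2 * discrete_bessel_J 0 c t + j 0)
      - (s\<^sup>2 - 1) * (\<Sum>l = 1..N. (1 / s) ^ (2 * l) * (j (l - 1) - 2 * discrete_bessel_J (4 * l) c t + j l)))"
    unfolding wave_profile_diff2
    unfolding mult_0_right add_0 power_0 mult_1 J0 JS
    by (simp only: right_diff_distrib sum_distrib_left mult_ac)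
  also have "\<dots> = (c / 2)\<^sup>2 * (lowered + raised - 2 * wave_profile s c N 0 t)"
    unfolding lowered_def raised_def wave_profile_def
    by (simp add: right_diff_distrib distrib_left sum.distrib sum_subtractf sum_distrib_left algebra_simps)
  also have up: "raised = s * wave_profile s c N (Suc 0) t"
    unfolding raised_def wave_profile_def using assms(1)
    by (simp add: j_def right_diff_distrib sum_distrib_left mult_ac add.commute)
  also have "lowered = wave_profile s c N (Suc 0) t / s"
    unfolding low up using assms(1) by (simp add: power2_eq_square)
  finally show ?thesis by (simp add: distrib_right add.commute)
qed

lemma wave_profile_initial:
  assumes "t \<le> 1"
  shows "wave_profile s c N r t = (if r = 0 then 1 else 0)"
proof -
  have "discrete_bessel_J (2 * r + 4 * l) c t = 0" if "l \<in> {1..N}" for l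
    using that assms by (intro discrete_bessel_J_eq_0) auto
  moreover have "discrete_bessel_J (2 * r) c t = (if r = 0 then 1 else 0)"
    using assms discrete_bessel_J_diff_0[of c 0]
    by (cases t) (auto simp: discrete_bessel_J_eq_0)
  ultimately show ?thesis by (simp add: wave_profile_def)
qed

section \<open>Distances in a regular tree\<close>

lemma graph_dist_refl [simp]: "graph_dist adj x x = 0"
  by (simp add: graph_dist_def)

lemma graph_dist_le: "(adj ^^ n) x y \<Longrightarrow> graph_dist adj x y \<le> n"
  unfolding graph_dist_def by (rule Least_le)

lemma graph_dist_walk:
  assumes "adj\<^sup>*\<^sup>* x y"
  shows "(adj ^^ graph_dist adj x y) x y"
  using assms unfolding graph_dist_def rtranclp_power by (rule LeastI_ex)

lemma graph_dist_eq_0_iff: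
  assumes "adj\<^sup>*\<^sup>* x y"
  shows "graph_dist adj x y = 0 \<longleftrightarrow> x = y"
  using graph_dist_walk[OF assms] by auto

lemma graph_dist_adj_le:
  assumes "adj\<^sup>*\<^sup>* x y" "adj y z"
  shows "graph_dist adj x z \<le> Suc (graph_dist adj x y)"
  using graph_dist_walk[OF assms(1)] assms(2) by (intro graph_dist_le) auto

lemma graph_dist_predecessor:
  assumes "adj\<^sup>*\<^sup>* x z" "graph_dist adj x z = Suc n"
  obtains y where "adj y z" "graph_dist adj x y = n"
proof -
  have "(adj ^^ Suc n) x z" using graph_dist_walk[OF assms(1)] assms(2) by simp
  then obtain y where y: "(adj ^^ n) x y" "adj y z" by auto
  then have "adj\<^sup>*\<^sup>* x y" by (auto simp: rtranclp_power)
  then have "n \<le> graph_dist adj x y" using graph_dist_adj_le[of adj x y z] y(2) assms(2) by simp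
  with graph_dist_le[OF y(1)] y(2) show ?thesis by (intro that) auto
qed

text \<open>
  Descend from both ends towards the root: as long as the two predecessors differ, they prolong the
  path at a smaller distance, and when they agree they close it to a cycle. They must agree
  at the root at the latest.
\<close>

lemma is_tree_no_path_above_endpoints:
  assumes "is_tree adj" "distinct p" "successively adj p" "p \<noteq> []" "hd p \<noteq> last p"
    and "graph_dist adj x0 (hd p) = n" "graph_dist adj x0 (last p) = n"
    and "\<forall>v\<in>set p. n \<le> graph_dist adj x0 v"
  shows False
  using assms(2-)
proof (induction n arbitrary: p)
  case 0
  have "adj\<^sup>*\<^sup>* x0 v" for v using assms(1) by (simp add: is_tree_def)
  then show ?case using 0 by (simp add: graph_dist_eq_0_iff)
next
  case (Suc n)
  have conn: "adj\<^sup>*\<^sup>* x0 v" for v using assms(1) by (simp add: is_tree_def)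
  have sym: "adj u v \<Longrightarrow> adj v u" for u v using assms(1) by (auto simp: is_tree_def dest: sympD)
  obtain y where y: "adj y (hd p)" "graph_dist adj x0 y = n"
    using graph_dist_predecessor[OF conn Suc.prems(5)] .
  obtain z where z: "adj z (last p)" "graph_dist adj x0 z = n"
    using graph_dist_predecessor[OF conn Suc.prems(6)] .
  have notin: "y \<notin> set p" "z \<notin> set p" using Suc.prems(7) y(2) z(2) by fastforce+
  have path: "successively adj (y # p)"
    using Suc.prems(2,3) y(1) by (cases p) auto
  show ?case
  proof (cases "y = z")
    case True
    have "2 \<le> length p" using Suc.prems(3,4) by (cases p rule: remdups_adj.cases) auto
    then have "3 \<le> length (y # p) \<and> distinct (y # p) \<and> successively adj (y # p)
        \<and> adj (last (y # p)) (hd (y # p))"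
      using path notin Suc.prems(1,3) sym[OF z(1)] True by auto
    then show ?thesis using assms(1) unfolding is_tree_def by blast
  next
    case False
    have "successively adj ((y # p) @ [z])"
      using path Suc.prems(3) sym[OF z(1)] by (subst successively_append_iff) auto
    then show ?thesis
      using Suc.IH[of "(y # p) @ [z]"] Suc.prems(1,7) notin y(2) z(2) False
      by (auto intro: order_trans[OF le_SucI[OF order_refl]] Suc_leD)
  qed
qed

lemma is_tree_adj_dist_neq:
  assumes "is_tree adj" "adj x y"
  shows "graph_dist adj x0 x \<noteq> graph_dist adj x0 y"
proof
  assume eq: "graph_dist adj x0 x = graph_dist adj x0 y"
  have "x \<noteq> y" using assms by (auto simp: is_tree_def irreflp_def)
  then show False
    using is_tree_no_path_above_endpoints[OF assms(1), of "[x, y]" x0] eq assms(2) by auto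
qed

lemma is_tree_predecessor_unique:
  assumes "is_tree adj" "adj y x" "adj z x"
    and "graph_dist adj x0 x = Suc n" "graph_dist adj x0 y = n" "graph_dist adj x0 z = n"
  shows "y = z"
proof (rule ccontr)
  assume "y \<noteq> z"
  moreover have "adj x z" using assms(1,3) by (auto simp: is_tree_def dest: sympD)
  moreover have "x \<noteq> y" "x \<noteq> z" using assms(4-6) by auto
  ultimately show False
    using is_tree_no_path_above_endpoints[OF assms(1), of "[y, x, z]" x0 n] assms by auto
qed

text \<open>
  Exactly one neighbour of a vertex other than the root is nearer to the root, and none is at the same
  distance.
\<close>

lemma regular_tree_neighbour_sum:
  fixes f :: "nat \<Rightarrow> real"
  assumes "regular_tree (q + 1) adj"
  shows "(\<Sum>y | adj x y. f (graph_dist adj x0 y)) =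
     (case graph_dist adj x0 x of 0 \<Rightarrow> (real q + 1) * f 1 | Suc n \<Rightarrow> f n + real q * f (n + 2))"
proof -
  have tree: "is_tree adj" and fin: "finite {y. adj x y}" and deg: "card {y. adj x y} = q + 1"
    using assms by (auto simp: regular_tree_def)
  have conn: "adj\<^sup>*\<^sup>* x0 v" for v using tree by (simp add: is_tree_def)
  have sym: "adj u v \<Longrightarrow> adj v u" for u v using tree by (auto simp: is_tree_def dest: sympD)
  have step: "graph_dist adj x0 y = Suc (graph_dist adj x0 x) \<or>
      Suc (graph_dist adj x0 y) = graph_dist adj x0 x" if "adj x y" for y
    using graph_dist_adj_le[OF conn that] graph_dist_adj_le[OF conn sym[OF that]]
      is_tree_adj_dist_neq[OF tree that, of x0] by force
  show ?thesis
  proof (cases "graph_dist adj x0 x")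
    case 0
    then have "(\<Sum>y | adj x y. f (graph_dist adj x0 y)) = (\<Sum>y | adj x y. f 1)"
      using step by (intro sum.cong) auto
    then show ?thesis using 0 deg by (simp add: add.commute)
  next
    case (Suc n)
    obtain p where p: "adj p x" "graph_dist adj x0 p = n"
      using graph_dist_predecessor[OF conn Suc] .
    have "graph_dist adj x0 y = n + 2" if "adj x y" "y \<noteq> p" for y
      using step[OF that(1)] Suc is_tree_predecessor_unique[OF tree sym[OF that(1)] p(1) Suc _ p(2)]
        that(2) by auto
    then have "(\<Sum>y \<in> {y. adj x y} - {p}. f (graph_dist adj x0 y)) = (\<Sum>y \<in> {y. adj x y} - {p}. f (n + 2))"
      by (intro sum.cong) auto
    also have "\<dots> = real q * f (n + 2)"
      using fin deg sym[OF p(1)] by simp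
    finally show ?thesis
      using Suc p(2) sum.remove[OF fin, of p "\<lambda>y. f (graph_dist adj x0 y)"] sym[OF p(1)] by simp
  qed
qed

section \<open>The wave kernels\<close>

lemma wave_kernel_W_eq_wave_solution:
  "wave_kernel_W q a b adj x0 x t = wave_solution q a b adj (delta x0) (\<lambda>_. 0) t x"
  unfolding wave_kernel_W_def wave_equation_iff[where f = "delta x0" and g = "\<lambda>_. 0"] by simp

lemma wave_kernel_V_eq_wave_solution:
  "wave_kernel_V q a b adj x0 x t = wave_solution q a b adj (\<lambda>_. 0) (delta x0) t x"
  unfolding wave_kernel_V_def wave_equation_iff[where f = "\<lambda>_. 0" and g = "delta x0"] by simp

lemma shifted_laplacian_sum:
  "shifted_laplacian q a b adj (\<lambda>y. \<Sum>m\<in>A. f m y) x = (\<Sum>m\<in>A. shifted_laplacian q a b adj (f m) x)"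
proof -
  have "(\<Sum>y | adj x y. \<Sum>m\<in>A. f m y) = (\<Sum>m\<in>A. \<Sum>y | adj x y. f m y)" by (rule sum.swap)
  then show ?thesis
    by (simp add: shifted_laplacian_def tree_laplacian_def sum_subtractf right_diff_distrib
        flip: sum_distrib_left)
qed

text \<open>
  The wave equation is linear and autonomous in \<open>t\<close>, so summing a solution over time gives a
  solution again: the second difference of the sum is \<open>\<partial>\<^sub>t u\<close>, and as \<open>\<partial>\<^sub>t u\<close> vanishes initially, it is
  the sum of the earlier second differences of \<open>u\<close>.
\<close>

lemma wave_solution_velocity_eq_sum:
  "wave_solution q a b adj (\<lambda>_. 0) g t x = (\<Sum>m<t. wave_solution q a b adj g (\<lambda>_. 0) m x)"
proof -
  define u where "u m = wave_solution q a b adj g (\<lambda>_. 0) m" for m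
  have rec: "u (Suc (Suc m)) x = 2 * u (Suc m) x - u m x - shifted_laplacian q a b adj (u m) x" for m x
    by (simp add: u_def)
  have vel: "u (Suc t) x - u t x = - (\<Sum>m<t. shifted_laplacian q a b adj (u m) x)" for t x
    by (induction t) (simp_all add: rec, simp add: u_def)
  have "wave_solution q a b adj (\<lambda>_. 0) g t = (\<lambda>x. \<Sum>m<t. u m x) \<and>
        wave_solution q a b adj (\<lambda>_. 0) g (Suc t) = (\<lambda>x. \<Sum>m<Suc t. u m x)"
  proof (induction t)
    case 0
    then show ?case by (simp add: u_def)
  next
    case (Suc t)
    then have eqs: "wave_solution q a b adj (\<lambda>_. 0) g t = (\<lambda>x. \<Sum>m<t. u m x)"
      "wave_solution q a b adj (\<lambda>_. 0) g (Suc t) = (\<lambda>x. \<Sum>m<Suc t. u m x)" by auto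
    have "wave_solution q a b adj (\<lambda>_. 0) g (Suc (Suc t)) x = (\<Sum>m<Suc (Suc t). u m x)" for x
      using vel[where t = t and x = x] by (simp add: eqs shifted_laplacian_sum)
    then show ?case using eqs(2) by blast
  qed
  then show ?thesis by (simp add: u_def)
qed

text \<open>
  The bound on \<open>t\<close> keeps the telescoping at the root exact at every earlier time.
\<close>

lemma wave_kernel_W_eq_wave_profile:
  assumes q: "q \<ge> 1" and a: "a = b * (real q + 1 - 2 * sqrt (real q))"
    and tree: "regular_tree (q + 1) adj"
    and c: "(c / 2)\<^sup>2 = b * sqrt (real q)"
    and "t < 4 * N + 2"
  shows "wave_kernel_W q a b adj x0 x t = wave_profile (sqrt (real q)) c N (graph_dist adj x0 x) t"
proof -
  define s where "s = sqrt (real q)"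
  have s: "s \<noteq> 0" "s\<^sup>2 = real q" using q by (auto simp: s_def)
  define d where "d = graph_dist adj x0"
  have conn: "adj\<^sup>*\<^sup>* x0 v" for v using tree by (simp add: regular_tree_def is_tree_def)
  have delta: "delta x0 v = (if d v = 0 then 1 else 0)" for v
    using graph_dist_eq_0_iff[OF conn, of v] by (auto simp: delta_def d_def)
  have "wave_solution q a b adj (delta x0) (\<lambda>_. 0) t = (\<lambda>x. wave_profile s c N (d x) t)"
    if "t < 4 * N + 2" for t
    using that
  proof (induction t rule: induct_nat_012)
    case (ge2 t)
    define P where "P r = wave_profile s c N r t" for r
    have lap: "shifted_laplacian q a b adj (\<lambda>x. P (d x)) x = - time_diff2 (wave_profile s c N (d x)) t" for x
    proof -
      have nb: "(\<Sum>y | adj x y. P (d y)) =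
          (case d x of 0 \<Rightarrow> (real q + 1) * P 1 | Suc n \<Rightarrow> P n + real q * P (n + 2))"
        unfolding d_def by (rule regular_tree_neighbour_sum[OF tree])
      have "shifted_laplacian q a b adj (\<lambda>x. P (d x)) x
          = b * s * (2 * P (d x)) - b * (\<Sum>y | adj x y. P (d y))"
        by (simp add: shifted_laplacian_def tree_laplacian_def a s_def algebra_simps)
      also have "\<dots> = - time_diff2 (wave_profile s c N (d x)) t"
      proof (cases "d x")
        case 0
        have "t < 4 * N + 2" using ge2.prems by simp
        then show ?thesis
          using 0 s c by (simp add: nb wave_profile_diff2_0 flip: P_def s_def)
            (simp add: field_simps power2_eq_square)
      next
        case (Suc n)
        then show ?thesis
          using s c by (simp add: nb wave_profile_diff2_Suc flip: P_def s_def)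
            (simp add: field_simps power2_eq_square)
      qed
      finally show ?thesis .
    qed
    have "wave_solution q a b adj (delta x0) (\<lambda>_. 0) (Suc (Suc t)) x = wave_profile s c N (d x) (Suc (Suc t))" for x
      using ge2 lap[of x] by (simp add: time_diff2_def P_def)
    then show ?case by blast
  qed (simp_all add: wave_profile_initial delta fun_eq_iff)
  from this[OF assms(5)] show ?thesis
    unfolding wave_kernel_W_eq_wave_solution s_def d_def by simp
qed

lemma powr_minus_half_nat:
  assumes "q > 0"
  shows "q powr (- real n / 2) = (1 / sqrt q) ^ n"
proof -
  have "q powr (- real n / 2) = (q powr (1 / 2)) powr (- real n)"
    by (simp add: powr_powr)
  also have "\<dots> = inverse (sqrt q ^ n)"
    using assms by (simp add: powr_half_sqrt powr_minus powr_realpow)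
  finally show ?thesis by (simp add: power_one_over inverse_eq_divide)
qed

theorem proposition5p1:
  fixes q :: nat and a b :: real
    and adj :: "'v \<Rightarrow> 'v \<Rightarrow> bool" and x0 x :: 'v
    and r t :: nat
  assumes "q \<ge> 1"
    and "b > 0"
    and "a = b * (real q + 1 - 2 * sqrt (real q))"
    and "regular_tree (q + 1) adj"
    and "graph_dist adj x0 x = r"
  shows "wave_kernel_W q a b adj x0 x t =
           real q powr (- real r / 2) * discrete_bessel_J (2 * r) (c_J q b) t
           - (real q - 1) *
             (\<Sum>l = 1..(t - 2 * r) div 4.
                real q powr (- (real r + 2 * real l) / 2)
                * discrete_bessel_J (2 * r + 4 * l) (c_J q b) t)
       \<and> (t \<ge> 1 \<longrightarrow>
         wave_kernel_V q a b adj x0 x t =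
           (\<Sum>m = 0..t - 1.
              real q powr (- real r / 2) * discrete_bessel_J (2 * r) (c_J q b) m
              - (real q - 1) *
                (\<Sum>l = 1..(t - 2 * r) div 4.
                   real q powr (- (real r + 2 * real l) / 2)
                   * discrete_bessel_J (2 * r + 4 * l) (c_J q b) m)))"
proof -
  define s where "s = sqrt (real q)"
  define c where "c = c_J q b"
  define M where "M = (t - 2 * r) div 4"
  have pos: "real q > 0" using assms(1) by simp
  have c: "(c / 2)\<^sup>2 = b * sqrt (real q)"
  proof -
    have "(c / 2)\<^sup>2 = (real q * b\<^sup>2) powr (1 / 2)"
      using pos assms(2) by (simp add: c_def c_J_def power2_eq_square flip: powr_add)
    then show ?thesis
      using pos assms(2) by (simp add: powr_half_sqrt real_sqrt_mult)
  qed
  have pw: "real q powr (- (real r + 2 * real l) / 2) = (1 / s) ^ (r + 2 * l)" for l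
    using powr_minus_half_nat[OF pos, of "r + 2 * l"] by (simp add: s_def)
  have profile: "real q powr (- real r / 2) * discrete_bessel_J (2 * r) c m
              - (real q - 1) *
                (\<Sum>l = 1..M. real q powr (- (real r + 2 * real l) / 2)
                   * discrete_bessel_J (2 * r + 4 * l) c m) = wave_profile s c M r m" for m
    using pos unfolding wave_profile_def pw powr_minus_half_nat[OF pos] s_def by simp
  \<comment> \<open>The number \<open>M\<close> of terms is the one for time \<open>t\<close>, also at the earlier times that enter \<open>V\<close>;
     the surplus terms have orders above \<open>m\<close>.\<close>
  have W: "wave_kernel_W q a b adj x0 x m = wave_profile s c M r m" if "m \<le> t" for m
  proof -
    have "wave_kernel_W q a b adj x0 x m = wave_profile s c t r m"
      using wave_kernel_W_eq_wave_profile[OF assms(1,3,4) c, of m t x0 x] that assms(5)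
      by (simp add: s_def)
    also have "\<dots> = wave_profile s c M r m"
      using that by (intro wave_profile_cong) (auto simp: M_def)
    finally show ?thesis .
  qed
  have V: "wave_kernel_V q a b adj x0 x t = (\<Sum>m = 0..t - 1. wave_profile s c M r m)" if "t \<ge> 1"
  proof -
    have "wave_kernel_V q a b adj x0 x t = (\<Sum>m<t. wave_kernel_W q a b adj x0 x m)"
      by (simp add: wave_kernel_V_eq_wave_solution wave_kernel_W_eq_wave_solution
          wave_solution_velocity_eq_sum)
    also have "\<dots> = (\<Sum>m = 0..t - 1. wave_profile s c M r m)"
      using that by (intro sum.cong) (auto simp: W)
    finally show ?thesis .
  qed
  show ?thesis
    using W[of t] V unfolding profile[unfolded c_def M_def] c_def M_def by simp
qed

end
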